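(* Let $\mathrm{CWENO}(P_{\mathrm{opt}},P_1,\ldots,P_{\widehat m})$ be a one-dimensional reconstruction with $P_{\mathrm{opt}}\in\mathbb{P}^G$ and $P_k$ of degree at most $g<G$ for all $k=1,\ldots,\widehat m$, with $d_0\ge\delta>0$. If a jump discontinuity is present in the stencil of the reconstruction polynomial, then $I[P_0]\asymp1$ for $h\to0$, where $P_0=\frac1{d_0}\big(P_{\mathrm{opt}}-\sum_{k=1}^{\widehat m}d_kP_k\big)$ and $I$ is the Jiang-Shu indicator.
   Context: Setting. The reconstruction is computed on a cell $\Omega$ of a one-dimensional grid; $h$ denotes the diameter of a generic cell of the grid, and asymptotics are for $h\to0$. The notation $f(h)\asymp g(h)$ (for $h\to0$) means that $\lim_{h\to0}f(h)/g(h)$ exists, is finite and not zero. The data are the cell averages $\overline{u}_j=\frac1{|\Omega_j|}\int_{\Omega_j}u\,\mathrm{d}x$ of a known function $u$, and the mesh size is chosen so that at most one discontinuity is present in the stencil. $\mathbb{P}^n$ denotes the polynomials of degree at most $n$. $P_{\mathrm{opt}}\in\mathbb{P}^G$ is the polynomial interpolating, in the sense of cell averages, the data on the whole stencil of $G+1$ consecutive cells containing $\Omega$; $P_1,\ldots,P_{\widehat m}$ ($\widehat m\ge1$) are polynomials of degree at most $g$ interpolating, in the sense of cell averages, the data on sub-stencils of the stencil of $P_{\mathrm{opt}}$. Linear coefficients. $d_0,\ldots,d_{\widehat m}\in[0,1]$ are positive real numbers with $\sum_{k=0}^{\widehat m}d_k=1$, independent of $h$. CWENO reconstruction. For $P_0$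 as in the claim, a small $\epsilon>0$ and $t\ge2$, set $\alpha_k=\dfrac{d_k}{(I[P_k]+\epsilon)^t}$, $\omega_k=\dfrac{\alpha_k}{\sum_{i=0}^{\widehat m}\alpha_i}$ for $k=0,\ldots,\widehat m$, and $\mathrm{CWENO}(P_{\mathrm{opt}},P_1,\ldots,P_{\widehat m})=\sum_{k=0}^{\widehat m}\omega_kP_k\in\mathbb{P}^G$. Jiang-Shu indicator of a polynomial $P$ on $\Omega$: $$I[P]=\sum_{l\ge1}\operatorname{diam}(\Omega)^{2l-1}\int_\Omega\Big(\tfrac{\mathrm{d}^l}{\mathrm{d}x^l}P(x)\Big)^2\mathrm{d}x .$$
   Formalization: Added: the jump's distance to each stencil end, and each cell diameter, divided by h has a positive limit; each P_k has degree below the number of cells of its fixed sub-stencil. Otherwise, e.g. if the jump's relative position oscillates, the limit of I[P_0] may not exist. *)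

theory Defs
  imports "HOL-Analysis.Analysis" "HOL-Computational_Algebra.Polynomial"
begin

definition same_order :: "(real \<Rightarrow> real) \<Rightarrow> (real \<Rightarrow> real) \<Rightarrow> bool" where
  "same_order f g \<longleftrightarrow> (\<exists>c. c \<noteq> 0 \<and> ((\<lambda>h. f h / g h) \<longlongrightarrow> c) (at_right 0))"

definition jump_discontinuity_at :: "(real \<Rightarrow> real) \<Rightarrow> real \<Rightarrow> bool" where
  "jump_discontinuity_at u z \<longleftrightarrow>
     (\<exists>ul ur. (u \<longlongrightarrow> ul) (at_left z) \<and> (u \<longlongrightarrow> ur) (at_right z) \<and> ul \<noteq> ur)"

(* A stencil is given by its increasing cell interfaces x 0, x 1, ...; it may be non-uniform. *)
definition cell :: "(nat \<Rightarrow> real) \<Rightarrow> nat \<Rightarrow> real set" where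
  "cell x j = {x j .. x (Suc j)}"

definition cell_average :: "(nat \<Rightarrow> real) \<Rightarrow> (real \<Rightarrow> real) \<Rightarrow> nat \<Rightarrow> real" where
  "cell_average x f j = integral (cell x j) f / measure lborel (cell x j)"

(* The degree bound makes p the unique interpolant: as many conditions as coefficients. *)
definition average_interpolant ::
    "(nat \<Rightarrow> real) \<Rightarrow> (real \<Rightarrow> real) \<Rightarrow> nat set \<Rightarrow> real poly \<Rightarrow> bool" where
  "average_interpolant x u S p \<longleftrightarrow>
     degree p < card S \<and> (\<forall>j\<in>S. cell_average x (poly p) j = cell_average x u j)"

definition jiang_shu :: "real set \<Rightarrow> real poly \<Rightarrow> real" where
  "jiang_shu \<Omega> p =
     (\<Sum>\<^sub>\<infinity>l\<in>{1..}. diameter \<Omega> ^ (2 * l - 1) * integral \<Omega> (\<lambda>y. (poly ((pderiv ^^ l) p) y)\<^sup>2))"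

definition cweno_P0 :: "nat \<Rightarrow> (nat \<Rightarrow> real) \<Rightarrow> real poly \<Rightarrow> (nat \<Rightarrow> real poly) \<Rightarrow> real poly" where
  "cweno_P0 m d Popt P = smult (1 / d 0) (Popt - (\<Sum>k = 1..m. smult (d k) (P k)))"

end

theory Submission
  imports Defs
begin

text \<open>Rescaled by \<open>y = (t - z) / h\<close>, the stencil converges to a fixed stencil around 0 and the
data \<open>u\<close> to a step function with a jump at 0. An interpolation problem in the sense of
cell averages is uniquely solvable on any nondegenerate cells, so the rescaled interpolants
converge, coefficient by coefficient, to the interpolants \<open>Q\<close> and \<open>R k\<close> of
the step function (\<open>interpolants_tendsto\<close>, \<open>scaled_cell_integral_tendsto\<close>).
The Jiang-Shu indicator is invariant under the rescaling and continuous
(\<open>jiang_shu_affine\<close>, \<open>jiang_shu_tendsto\<close>), so the indicator of P0 converges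
to the indicator of the polynomial \<open>(Q - (\<Sum>k=1..m. d k * R k)) / d 0\<close> on a cell of
positive length. This limit is finite, and nonzero as soon as the polynomial is not constant
(\<open>jiang_shu_pos\<close>).

The polynomial \<open>Q\<close> is not constant, since on two or more cells a constant cannot have the
averages of a step function that jumps inside the stencil (\<open>step_interpolant_nonconstant\<close>). Its degree may
however be smaller than the number of cells allows: on three equal cells with the jump at the centre
of the middle one, \<open>Q\<close> is linear. Comparing degrees of \<open>Q\<close> and
\<open>R k\<close> is therefore not enough. But if the degree of \<open>R k\<close> is not below that of
\<open>Q\<close>, then the substencil of \<open>R k\<close> determines polynomials of the degree of
\<open>Q\<close>, and \<open>R k = Q\<close>. So at the degree of \<open>Q\<close> every
\<open>R k\<close> has either the coefficient 0 or the leading coefficient of \<open>Q\<close>, and as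
\<open>d 1, ..., d m\<close> sum to \<open>1 - d 0 < 1\<close>, the coefficient of the combination is a
positive multiple of the latter (\<open>degree_cweno_P0\<close>).\<close>

section \<open>Antiderivatives of polynomials\<close>

text \<open>The primitive vanishing at 0. With it the integral of a polynomial over a cell becomes a
difference of two values of a polynomial, hence an expression in its coefficients and the two
cell interfaces that passes to the limit without any integration theory.\<close>

definition antideriv :: "real poly \<Rightarrow> real poly" where
  "antideriv p = (\<Sum>i\<le>degree p. monom (coeff p i / real (Suc i)) (Suc i))"

lemma coeff_antideriv: "coeff (antideriv p) n = (if n = 0 then 0 else coeff p (n - 1) / real n)"
proof (cases n)
  case (Suc k)
  have "coeff (antideriv p) n =
      (\<Sum>i\<le>degree p. if i = k then coeff p i / real (Suc i) else 0)"
    unfolding antideriv_def coeff_sum using Suc by (intro sum.cong) auto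
  then show ?thesis using Suc by (auto simp: sum.delta coeff_eq_0)
qed (simp add: antideriv_def coeff_sum)

lemma pderiv_antideriv: "pderiv (antideriv p) = p"
  by (rule poly_eqI) (simp add: coeff_pderiv coeff_antideriv del: of_nat_Suc)

lemma antideriv_diff: "antideriv (p - q) = antideriv p - antideriv q"
  by (rule poly_eqI) (simp add: coeff_antideriv diff_divide_distrib)

lemma degree_antideriv_le: "degree (antideriv p) \<le> Suc (degree p)"
  by (rule degree_le) (auto simp: coeff_antideriv coeff_eq_0)

lemma integral_poly_pderiv:
  fixes p :: "real poly"
  assumes "a \<le> b"
  shows "integral {a..b} (poly (pderiv p)) = poly p b - poly p a"
proof (intro integral_unique fundamental_theorem_of_calculus assms)
  fix y show "(poly p has_vector_derivative poly (pderiv p) y) (at y within {a..b})"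
    using poly_DERIV[of p y] has_field_derivative_at_within
    by (metis has_real_derivative_iff_has_vector_derivative)
qed

lemma integral_poly:
  "a \<le> b \<Longrightarrow> integral {a..b} (poly p) = poly (antideriv p) b - poly (antideriv p) a"
  using integral_poly_pderiv[of a b "antideriv p"] by (simp add: pderiv_antideriv)

lemma poly_fun_simps:
  fixes p q :: "real poly"
  shows "poly (smult c p) = (\<lambda>y. c * poly p y)"
    and "poly (p\<^sup>2) = (\<lambda>y. (poly p y)\<^sup>2)"
    and "poly (pcompose p q) = (\<lambda>y. poly p (poly q y))"
  by (auto simp: poly_pcompose)

lemma integral_poly_affine:
  fixes p :: "real poly"
  assumes "0 < h" "a \<le> b"
  shows "integral {z + h * a..z + h * b} (poly p) = h * integral {a..b} (poly (pcompose p [:z, h:]))"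
proof -
  have "h * integral {a..b} (poly (pcompose p [:z, h:])) =
      integral {a..b} (poly (pderiv (pcompose (antideriv p) [:z, h:])))"
    by (simp add: pderiv_pcompose pderiv_antideriv pderiv_pCons poly_fun_simps)
  also have "\<dots> = poly (antideriv p) (z + h * b) - poly (antideriv p) (z + h * a)"
    using assms by (simp add: integral_poly_pderiv poly_pcompose mult.commute)
  finally show ?thesis using assms by (simp add: integral_poly)
qed

section \<open>Cell integrals determine a polynomial\<close>

text \<open>Vanishing of the integral over a cell forces a zero in its interior, by the mean value theorem for
the primitive. Distinct cells have disjoint interiors, so a nonzero polynomial cannot have as many
such cells as its degree bound allows coefficients.\<close>

lemma poly_eq_0_if_cell_integrals_vanish:
  fixes p :: "real poly" and Y :: "nat \<Rightarrow> real"
  assumes Y: "\<And>j. j \<le> G \<Longrightarrow> Y j < Y (Suc j)" and S: "S \<subseteq> {..G}"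
    and deg: "degree p < card S"
    and zero: "\<And>j. j \<in> S \<Longrightarrow> poly (antideriv p) (Y (Suc j)) = poly (antideriv p) (Y j)"
  shows "p = 0"
proof (rule ccontr)
  assume "p \<noteq> 0"
  have "\<exists>r. Y j < r \<and> r < Y (Suc j) \<and> poly p r = 0" if "j \<in> S" for j
  proof -
    have "Y j < Y (Suc j)" using Y S that by auto
    then show ?thesis
      using poly_MVT[of "Y j" "Y (Suc j)" "antideriv p"] zero[OF that]
      by (auto simp: pderiv_antideriv)
  qed
  then obtain r where r: "\<And>j. j \<in> S \<Longrightarrow> Y j < r j \<and> r j < Y (Suc j) \<and> poly p (r j) = 0"
    by metis
  have mono: "Y i \<le> Y j" if "i \<le> j" "j \<le> Suc G" for i j
    using that
  proof (induction rule: dec_induct)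
    case (step n)
    then show ?case using Y[of n] by simp
  qed simp
  have "r i < r j" if "i \<in> S" "j \<in> S" "i < j" for i j
    using r[OF that(1)] r[OF that(2)] mono[of "Suc i" j] that S by fastforce
  then have "inj_on r S"
    by (intro inj_onI) (metis less_irrefl linorder_neqE_nat)
  then have "card S = card (r ` S)" by (simp add: card_image)
  also have "\<dots> \<le> card {y. poly p y = 0}"
    using r \<open>p \<noteq> 0\<close> by (intro card_mono poly_roots_finite) auto
  also have "\<dots> \<le> degree p"
    using \<open>p \<noteq> 0\<close> by (rule card_poly_roots_bound)
  finally show False using deg by simp
qed

section \<open>Interpolating a step function\<close>

text \<open>The primitive, vanishing at 0, of the step function that jumps from \<open>ul\<close> to
\<open>ur\<close> at 0. Its positive homogeneity reflects that the step function is invariant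
under scaling.\<close>

definition hinge :: "real \<Rightarrow> real \<Rightarrow> real \<Rightarrow> real" where
  "hinge ul ur t = ul * min t 0 + ur * max t 0"

text \<open>A constant \<open>v\<close> with the cell integrals of a step function makes
\<open>hinge ul ur t - v * t\<close> take the same value at all interfaces. This function is linear on
either side of 0, and there are interfaces on both sides and at least three in all, so some side has
two of them (an interface at 0 counts for either side). The function is then constant on that
side, so \<open>v\<close> is the step value there and the common value is 0; a nonzero interface on the
other side makes \<open>v\<close> the step value there as well. The bound \<open>1 \<le> G\<close> is
needed: the average over a single cell is a constant interpolant.\<close>

lemma step_interpolant_nonconstant:
  fixes q :: "real poly" and Y :: "nat \<Rightarrow> real"
  assumes "1 \<le> G" and Y: "\<And>j. j \<le> G \<Longrightarrow> Y j < Y (Suc j)"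
    and Y0: "Y 0 < 0" and YG: "0 < Y (Suc G)" and "ul \<noteq> ur"
    and data: "\<And>j. j \<le> G \<Longrightarrow> poly (antideriv q) (Y (Suc j)) - poly (antideriv q) (Y j) =
      hinge ul ur (Y (Suc j)) - hinge ul ur (Y j)"
  shows "1 \<le> degree q"
proof (rule ccontr)
  assume "\<not> 1 \<le> degree q"
  then have "degree q = 0" by simp
  then obtain v where v: "q = [:v:]" by (rule degree_eq_zeroE)
  have antideriv: "poly (antideriv q) y = v * y" for y
    by (simp add: v antideriv_def poly_monom)
  have eq: "hinge ul ur (Y j) - v * Y j = hinge ul ur (Y 0) - v * Y 0" if "j \<le> Suc G" for j
    using that
  proof (induction j)
    case (Suc j)
    then show ?case using data[of j] by (simp add: antideriv)
  qed simp
  have "Y 1 \<le> Y j" if "1 \<le> j" "j \<le> G" for j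
    using that
  proof (induction rule: dec_induct)
    case (step n)
    then show ?case using Y[of n] by simp
  qed simp
  from this[of G] have Y1: "Y 0 < Y 1" "Y 1 < Y (Suc G)"
    using Y[of 0] Y[of G] \<open>1 \<le> G\<close> by auto
  show False
  proof (cases "Y 1 \<le> 0")
    case True
    then have "(ul - v) * (Y 1 - Y 0) = 0"
      using eq[of 1] Y0 by (simp add: hinge_def algebra_simps)
    then have "ul = v" using Y1 by simp
    then have "(ur - v) * Y (Suc G) = 0"
      using eq[of "Suc G"] Y0 YG by (simp add: hinge_def algebra_simps)
    then show False using YG \<open>ul = v\<close> \<open>ul \<noteq> ur\<close> by simp
  next
    case False
    then have "(ur - v) * (Y (Suc G) - Y 1) = 0"
      using eq[of 1] eq[of "Suc G"] YG \<open>1 \<le> G\<close> by (simp add: hinge_def algebra_simps)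
    then have "ur = v" using Y1 by simp
    then have "(ul - v) * Y 0 = 0"
      using eq[of "Suc G"] Y0 YG by (simp add: hinge_def algebra_simps)
    then show False using Y0 \<open>ur = v\<close> \<open>ul \<noteq> ur\<close> by simp
  qed
qed

section \<open>Linear systems whose coefficients converge\<close>

text \<open>Solutions of a linear system converge when its coefficients and right-hand sides do and the limit
system is injective. The proof is Gaussian elimination, by induction on the number of unknowns:
injectivity supplies a row \<open>i0\<close> whose limit coefficient of the last unknown is
nonzero, and eliminating that unknown with this row preserves all the hypotheses. The equations are
indexed by an arbitrary set because they will be the cells of a substencil.\<close>

lemma linear_system_solutions_tendsto:
  fixes A :: "'a \<Rightarrow> 'i \<Rightarrow> nat \<Rightarrow> real"
  assumes "\<And>i j. i \<in> S \<Longrightarrow> j < N \<Longrightarrow> ((\<lambda>h. A h i j) \<longlongrightarrow> B i j) F"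
    and "\<And>i. i \<in> S \<Longrightarrow> ((\<lambda>h. \<Sum>j<N. A h i j * c h j) \<longlongrightarrow> b i) F"
    and "\<And>v j. (\<And>i. i \<in> S \<Longrightarrow> (\<Sum>j<N. B i j * v j) = 0) \<Longrightarrow> j < N \<Longrightarrow> v j = 0"
  shows "\<exists>v. \<forall>j<N. ((\<lambda>h. c h j) \<longlongrightarrow> v j) F"
  using assms
proof (induction N arbitrary: A B b)
  case 0
  then show ?case by simp
next
  case (Suc N)
  note A = Suc.prems(1) and rhs = Suc.prems(2) and inj = Suc.prems(3)
  obtain i0 where i0: "i0 \<in> S" "B i0 N \<noteq> 0"
  proof (rule ccontr)
    assume "\<not> thesis"
    then have "\<And>i. i \<in> S \<Longrightarrow> B i N = 0" using that by blast
    then have "(\<Sum>j<Suc N. B i j * (if j = N then 1 else 0)) = 0" if "i \<in> S" for i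
      using that by (simp add: sum.neutral)
    from inj[of "\<lambda>j. if j = N then 1 else 0", OF this, of N] show False by simp
  qed
  \<comment> \<open>\<open>f\<close> is the multiple of the pivot row that clears the last unknown from row \<open>i\<close>.\<close>
  define f where "f h i = A h i N / A h i0 N" for h i
  define f' where "f' i = B i N / B i0 N" for i
  have f: "((\<lambda>h. f h i) \<longlongrightarrow> f' i) F" if "i \<in> S" for i
    unfolding f_def f'_def using A i0 that by (intro tendsto_divide) auto
  have nz: "\<forall>\<^sub>F h in F. A h i0 N \<noteq> 0"
    using A[OF i0(1), of N] i0(2) by (intro tendsto_imp_eventually_ne) auto
  have "\<exists>v. \<forall>j<N. ((\<lambda>h. c h j) \<longlongrightarrow> v j) F"
  proof (rule Suc.IH)
    fix i j assume "i \<in> S" "j < N"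
    then show "((\<lambda>h. A h i j - f h i * A h i0 j) \<longlongrightarrow> B i j - f' i * B i0 j) F"
      using A i0 f by (intro tendsto_diff tendsto_mult) auto
  next
    fix i assume i: "i \<in> S"
    have "((\<lambda>h. (\<Sum>j<Suc N. A h i j * c h j) - f h i * (\<Sum>j<Suc N. A h i0 j * c h j))
        \<longlongrightarrow> b i - f' i * b i0) F"
      using i by (intro tendsto_diff tendsto_mult rhs f i0(1))
    then show "((\<lambda>h. \<Sum>j<N. (A h i j - f h i * A h i0 j) * c h j) \<longlongrightarrow> b i - f' i * b i0) F"
    proof (rule Lim_transform_eventually)
      show "\<forall>\<^sub>F h in F. (\<Sum>j<Suc N. A h i j * c h j) - f h i * (\<Sum>j<Suc N. A h i0 j * c h j) =
          (\<Sum>j<N. (A h i j - f h i * A h i0 j) * c h j)"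
        using nz
      proof eventually_elim
        case (elim h)
        then have "f h i * A h i0 N = A h i N" by (simp add: f_def)
        then have "f h i * (A h i0 N * c h N) = A h i N * c h N"
          by (metis mult.assoc)
        then show ?case
          by (auto simp: algebra_simps sum_subtractf sum_distrib_left)
      qed
    qed
  next
    fix v j
    assume v: "\<And>i. i \<in> S \<Longrightarrow> (\<Sum>j<N. (B i j - f' i * B i0 j) * v j) = 0" and "j < N"
    \<comment> \<open>A solution of the reduced system extends to one of the full system by solving the pivot row for the last unknown.\<close>
    define t where "t = - (\<Sum>j<N. B i0 j * v j) / B i0 N"
    have "(\<Sum>j<Suc N. B i j * (if j < N then v j else t)) = 0" if i: "i \<in> S" for i
    proof -
      have "(\<Sum>j<N. B i j * v j) = f' i * (\<Sum>j<N. B i0 j * v j)"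
        using v[OF i] by (simp add: algebra_simps sum_subtractf sum_distrib_left)
      then show ?thesis using i0 by (simp add: t_def f'_def)
    qed
    from inj[of "\<lambda>j. if j < N then v j else t", OF this, of j] show "v j = 0"
      using \<open>j < N\<close> by simp
  qed
  then obtain v where v: "\<And>j. j < N \<Longrightarrow> ((\<lambda>h. c h j) \<longlongrightarrow> v j) F" by blast
  have "((\<lambda>h. ((\<Sum>j<Suc N. A h i0 j * c h j) - (\<Sum>j<N. A h i0 j * c h j)) / A h i0 N)
      \<longlongrightarrow> (b i0 - (\<Sum>j<N. B i0 j * v j)) / B i0 N) F"
    using i0 A v by (intro tendsto_divide tendsto_diff tendsto_sum tendsto_mult rhs) auto
  then have "((\<lambda>h. c h N) \<longlongrightarrow> (b i0 - (\<Sum>j<N. B i0 j * v j)) / B i0 N) F"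
  proof (rule Lim_transform_eventually)
    show "\<forall>\<^sub>F h in F. ((\<Sum>j<Suc N. A h i0 j * c h j) - (\<Sum>j<N. A h i0 j * c h j)) / A h i0 N = c h N"
      using nz by eventually_elim simp
  qed
  with v have "\<forall>j<Suc N. ((\<lambda>h. c h j) \<longlongrightarrow>
      (if j < N then v j else (b i0 - (\<Sum>j<N. B i0 j * v j)) / B i0 N)) F"
    by (auto simp: less_Suc_eq)
  then show ?case
    by (intro exI[of _ "\<lambda>j. if j < N then v j else (b i0 - (\<Sum>j<N. B i0 j * v j)) / B i0 N"])
qed

section \<open>Coefficientwise convergence of polynomials\<close>

lemma poly_eq_sum_lessThan: "degree p < N \<Longrightarrow> poly p y = (\<Sum>i<N. coeff p i * y ^ i)"
  for p :: "real poly"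
  unfolding poly_altdef by (intro sum.mono_neutral_left) (auto simp: coeff_eq_0)

lemma poly_antideriv_eq_sum:
  assumes "degree p < N"
  shows "poly (antideriv p) y = (\<Sum>i<N. y ^ Suc i / real (Suc i) * coeff p i)"
proof -
  have "poly (antideriv p) y = (\<Sum>i\<le>degree p. y ^ Suc i / real (Suc i) * coeff p i)"
    by (simp add: antideriv_def poly_sum poly_monom mult.commute del: of_nat_Suc power_Suc)
  also have "\<dots> = (\<Sum>i<N. y ^ Suc i / real (Suc i) * coeff p i)"
    using assms by (intro sum.mono_neutral_left) (auto simp: coeff_eq_0)
  finally show ?thesis .
qed

text \<open>Convergence in the finite-dimensional space of polynomials of degree at most \<open>N\<close>.
The degree bound keeps it compatible with evaluation at moving points: without it,
\<open>h * y ^ n\<close> with \<open>n\<close> growing as \<open>h\<close> tends to 0 converges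
coefficientwise to 0 but can diverge at points \<open>y > 1\<close>.\<close>

definition poly_tendsto :: "nat \<Rightarrow> ('a \<Rightarrow> real poly) \<Rightarrow> real poly \<Rightarrow> 'a filter \<Rightarrow> bool" where
  "poly_tendsto N p q F \<longleftrightarrow> (\<forall>\<^sub>F h in F. degree (p h) \<le> N) \<and> degree q \<le> N \<and>
     (\<forall>i. ((\<lambda>h. coeff (p h) i) \<longlongrightarrow> coeff q i) F)"

lemma poly_tendsto_pderiv:
  "poly_tendsto N p q F \<Longrightarrow> poly_tendsto N (\<lambda>h. pderiv (p h)) (pderiv q) F"
  unfolding poly_tendsto_def coeff_pderiv degree_pderiv
proof (intro conjI allI)
  assume p: "(\<forall>\<^sub>F h in F. degree (p h) \<le> N) \<and> degree q \<le> N \<and>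
    (\<forall>i. ((\<lambda>h. coeff (p h) i) \<longlongrightarrow> coeff q i) F)"
  show "\<forall>\<^sub>F h in F. degree (p h) - 1 \<le> N"
    by (rule eventually_mono[OF conjunct1[OF p]]) simp
  show "degree q - 1 \<le> N" using conjunct1[OF conjunct2[OF p]] by linarith
  show "((\<lambda>h. of_nat (Suc i) * coeff (p h) (Suc i)) \<longlongrightarrow> of_nat (Suc i) * coeff q (Suc i)) F" for i
    using p by (intro tendsto_mult tendsto_const) blast
qed

lemma poly_tendsto_pderiv_funpow:
  "poly_tendsto N p q F \<Longrightarrow> poly_tendsto N (\<lambda>h. (pderiv ^^ l) (p h)) ((pderiv ^^ l) q) F"
  by (induction l) (simp_all add: poly_tendsto_pderiv)

lemma poly_tendsto_square:
  assumes "poly_tendsto N p q F"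
  shows "poly_tendsto (2 * N) (\<lambda>h. (p h)\<^sup>2) (q\<^sup>2) F"
proof -
  have deg: "degree (r\<^sup>2) \<le> 2 * N" if "degree r \<le> N" for r :: "real poly"
    using degree_power_le[of r 2] that by (simp add: mult.commute)
  have "((\<lambda>h. coeff ((p h)\<^sup>2) i) \<longlongrightarrow> coeff (q\<^sup>2) i) F" for i
    unfolding power2_eq_square coeff_mult
    using assms by (intro tendsto_sum tendsto_mult) (auto simp: poly_tendsto_def)
  then show ?thesis
    using assms deg by (auto simp: poly_tendsto_def elim: eventually_mono)
qed

lemma poly_tendsto_antideriv:
  assumes "poly_tendsto N p q F"
  shows "poly_tendsto (Suc N) (\<lambda>h. antideriv (p h)) (antideriv q) F"
proof -
  have "((\<lambda>h. coeff (antideriv (p h)) i) \<longlongrightarrow> coeff (antideriv q) i) F" for i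
    using assms by (auto simp: coeff_antideriv poly_tendsto_def intro!: tendsto_divide)
  moreover have "degree (antideriv r) \<le> Suc N" if "degree r \<le> N" for r
    using degree_antideriv_le[of r] that by simp
  ultimately show ?thesis
    using assms by (auto simp: poly_tendsto_def elim: eventually_mono)
qed

lemma poly_tendsto_eval:
  assumes "poly_tendsto N p q F" "(X \<longlongrightarrow> a) F"
  shows "((\<lambda>h. poly (p h) (X h)) \<longlongrightarrow> poly q a) F"
proof -
  have sum: "poly r y = (\<Sum>i<Suc N. coeff r i * y ^ i)" if "degree r \<le> N" for r :: "real poly" and y
    using that by (intro poly_eq_sum_lessThan) simp
  have "((\<lambda>h. \<Sum>i<Suc N. coeff (p h) i * X h ^ i) \<longlongrightarrow> (\<Sum>i<Suc N. coeff q i * a ^ i)) F"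
    using assms by (intro tendsto_sum tendsto_mult tendsto_power) (auto simp: poly_tendsto_def)
  moreover have "\<forall>\<^sub>F h in F. (\<Sum>i<Suc N. coeff (p h) i * X h ^ i) = poly (p h) (X h)"
    by (rule eventually_mono[OF conjunct1[OF assms(1)[unfolded poly_tendsto_def]]]) (rule sum[symmetric])
  moreover have "(\<Sum>i<Suc N. coeff q i * a ^ i) = poly q a"
    using assms by (intro sum[symmetric]) (simp add: poly_tendsto_def)
  ultimately show ?thesis using Lim_transform_eventually by fastforce
qed

text \<open>The interpolation conditions form a linear system in the coefficients whose matrix depends
continuously on the interfaces. The limit system is injective because the limit cells are still
nondegenerate, so that a polynomial is determined by its integrals over them; hence the
coefficients converge, and their limits solve the limit interpolation problem.\<close>

lemma interpolants_tendsto: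
  fixes X :: "'a \<Rightarrow> nat \<Rightarrow> real" and p :: "'a \<Rightarrow> real poly"
  assumes F: "F \<noteq> bot"
    and Y: "\<And>j. j \<le> G \<Longrightarrow> Y j < Y (Suc j)" and S: "S \<subseteq> {..G}"
    and X: "\<And>j. j \<le> Suc G \<Longrightarrow> ((\<lambda>h. X h j) \<longlongrightarrow> Y j) F"
    and deg: "\<forall>\<^sub>F h in F. degree (p h) < card S"
    and data: "\<And>j. j \<in> S \<Longrightarrow>
      ((\<lambda>h. poly (antideriv (p h)) (X h (Suc j)) - poly (antideriv (p h)) (X h j)) \<longlongrightarrow> T j) F"
  obtains q where "degree q < card S" "\<And>N. card S \<le> Suc N \<Longrightarrow> poly_tendsto N p q F"
    "\<And>j. j \<in> S \<Longrightarrow> poly (antideriv q) (Y (Suc j)) - poly (antideriv q) (Y j) = T j"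
proof -
  define w where "w a b i = (b ^ Suc i - a ^ Suc i) / real (Suc i)" for a b :: real and i
  have int: "poly (antideriv r) b - poly (antideriv r) a = (\<Sum>i<card S. w a b i * coeff r i)"
    if "degree r < card S" for r a b
    using that
    by (simp add: poly_antideriv_eq_sum sum_subtractf[symmetric] w_def diff_divide_distrib
        left_diff_distrib del: of_nat_Suc power_Suc)
  have "\<exists>h. degree (p h) < card S" using deg F eventually_happens' by blast
  then have pos: "0 < card S" by auto
  have "\<exists>v. \<forall>i<card S. ((\<lambda>h. coeff (p h) i) \<longlongrightarrow> v i) F"
  proof (rule linear_system_solutions_tendsto[where S = S])
    fix j i assume "j \<in> S"
    then have "j \<le> G" using S by auto
    then show "((\<lambda>h. w (X h j) (X h (Suc j)) i) \<longlongrightarrow> w (Y j) (Y (Suc j)) i) F"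
      unfolding w_def by (intro tendsto_intros X) auto
  next
    fix j assume "j \<in> S"
    from data[OF this]
    show "((\<lambda>h. \<Sum>i<card S. w (X h j) (X h (Suc j)) i * coeff (p h) i) \<longlongrightarrow> T j) F"
    proof (rule Lim_transform_eventually)
      show "\<forall>\<^sub>F h in F. poly (antideriv (p h)) (X h (Suc j)) - poly (antideriv (p h)) (X h j) =
          (\<Sum>i<card S. w (X h j) (X h (Suc j)) i * coeff (p h) i)"
        using deg by (rule eventually_mono) (rule int)
    qed
  next
    fix v i
    assume v: "\<And>j. j \<in> S \<Longrightarrow> (\<Sum>i<card S. w (Y j) (Y (Suc j)) i * v i) = 0" and i: "i < card S"
    define r where "r = (\<Sum>i<card S. monom (v i) i)"
    have coeff: "coeff r n = (if n < card S then v n else 0)" for n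
      by (simp add: r_def coeff_sum sum.delta)
    have r: "degree r < card S"
      using pos by (intro degree_lessI) (auto simp: coeff)
    have "poly (antideriv r) (Y (Suc j)) = poly (antideriv r) (Y j)" if "j \<in> S" for j
    proof -
      have "poly (antideriv r) (Y (Suc j)) - poly (antideriv r) (Y j) =
          (\<Sum>i<card S. w (Y j) (Y (Suc j)) i * coeff r i)"
        by (rule int[OF r])
      also have "\<dots> = 0" using v[OF that] by (simp add: coeff)
      finally show ?thesis by simp
    qed
    with Y S r have "r = 0" by (rule poly_eq_0_if_cell_integrals_vanish)
    then show "v i = 0" using coeff[of i] i by simp
  qed
  then obtain v where v: "\<And>i. i < card S \<Longrightarrow> ((\<lambda>h. coeff (p h) i) \<longlongrightarrow> v i) F" by blast
  define q where "q = (\<Sum>i<card S. monom (v i) i)"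
  have coeff: "coeff q n = (if n < card S then v n else 0)" for n
    by (simp add: q_def coeff_sum sum.delta)
  have q: "degree q < card S"
    using pos by (intro degree_lessI) (auto simp: coeff)
  have lim: "((\<lambda>h. coeff (p h) n) \<longlongrightarrow> coeff q n) F" for n
  proof (cases "n < card S")
    case False
    have "\<forall>\<^sub>F h in F. 0 = coeff (p h) n"
      using deg by (rule eventually_mono) (use False in \<open>auto simp: coeff_eq_0\<close>)
    then show ?thesis using False by (auto simp: coeff intro: Lim_transform_eventually)
  qed (simp add: coeff v)
  have tends: "poly_tendsto N p q F" if "card S \<le> Suc N" for N
    using deg q lim that by (auto simp: poly_tendsto_def elim!: eventually_mono)
  have "poly (antideriv q) (Y (Suc j)) - poly (antideriv q) (Y j) = T j" if "j \<in> S" for j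
  proof (rule tendsto_unique[OF F _ data[OF that]])
    have "j \<le> G" using that S by auto
    then show "((\<lambda>h. poly (antideriv (p h)) (X h (Suc j)) - poly (antideriv (p h)) (X h j))
        \<longlongrightarrow> poly (antideriv q) (Y (Suc j)) - poly (antideriv q) (Y j)) F"
      using tends[of "card S"] by (intro tendsto_diff poly_tendsto_eval[OF poly_tendsto_antideriv] X) auto
  qed
  then show thesis using that q tends by blast
qed

section \<open>The Jiang-Shu indicator\<close>

lemma pderiv_funpow_eq_0: "degree p < l \<Longrightarrow> (pderiv ^^ l) p = 0" for p :: "real poly"
proof (induction l arbitrary: p)
  case (Suc l)
  show ?case
  proof (cases "degree p = 0")
    case True
    then have "pderiv p = 0" by (simp add: pderiv_eq_0_iff)
    moreover have "(pderiv ^^ l) 0 = (0 :: real poly)" by (induction l) auto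
    ultimately show ?thesis by (simp add: funpow_Suc_right del: funpow.simps)
  next
    case False
    then show ?thesis using Suc
      by (simp add: funpow_Suc_right degree_pderiv del: funpow.simps)
  qed
qed simp

lemma jiang_shu_eq_sum:
  assumes "a < b" "degree p \<le> N"
  shows "jiang_shu {a..b} p =
    (\<Sum>l=1..N. (b - a) ^ (2 * l - 1) * integral {a..b} (\<lambda>y. (poly ((pderiv ^^ l) p) y)\<^sup>2))"
proof -
  have "jiang_shu {a..b} p =
    (\<Sum>\<^sub>\<infinity>l\<in>{1..N}. (b - a) ^ (2 * l - 1) * integral {a..b} (\<lambda>y. (poly ((pderiv ^^ l) p) y)\<^sup>2))"
    unfolding jiang_shu_def using assms
    by (intro infsum_cong_neutral) (auto simp: pderiv_funpow_eq_0)
  then show ?thesis by simp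
qed

lemma pderiv_funpow_pcompose_affine:
  "(pderiv ^^ l) (pcompose p [:z, h:]) = smult (h ^ l) (pcompose ((pderiv ^^ l) p) [:z, h:])"
  for p :: "real poly"
  by (induction l) (simp_all add: pderiv_smult pderiv_pcompose pderiv_pCons mult.commute)

text \<open>The powers of the diameter in the indicator are there for this: each of its terms is invariant under
affine changes of variable. Passing to the rescaled variable multiplies the integral of the squared
derivative of order \<open>l\<close> by \<open>h ^ (2 * l - 1)\<close>, and the power of the
diameter is divided by the same factor.\<close>

lemma jiang_shu_affine:
  assumes "0 < h" "a < b"
  shows "jiang_shu {z + h * a..z + h * b} p = jiang_shu {a..b} (pcompose p [:z, h:])"
  unfolding jiang_shu_def
proof (rule infsum_cong)
  fix l :: nat assume "l \<in> {1..}"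
  then have l: "2 * l = Suc (2 * l - 1)" by auto
  let ?r = "(pderiv ^^ l) p"
  have "integral {z + h * a..z + h * b} (\<lambda>y. (poly ?r y)\<^sup>2) =
      h * integral {a..b} (\<lambda>y. (poly (pcompose ?r [:z, h:]) y)\<^sup>2)"
    using integral_poly_affine[of h a b z "?r\<^sup>2"] assms
    by (simp add: poly_fun_simps)
  moreover have "integral {a..b} (\<lambda>y. (poly ((pderiv ^^ l) (pcompose p [:z, h:])) y)\<^sup>2) =
      h ^ (2 * l) * integral {a..b} (\<lambda>y. (poly (pcompose ?r [:z, h:]) y)\<^sup>2)"
    by (simp add: pderiv_funpow_pcompose_affine power_mult_distrib power_mult[symmetric] mult.commute)
  moreover have "diameter {z + h * a..z + h * b} = h * diameter {a..b}"
    using assms by (simp add: right_diff_distrib)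
  moreover have "h ^ (2 * l) = h * h ^ (2 * l - 1)" using l by (metis power_Suc)
  ultimately show "diameter {z + h * a..z + h * b} ^ (2 * l - 1) *
      integral {z + h * a..z + h * b} (\<lambda>y. (poly ?r y)\<^sup>2) =
    diameter {a..b} ^ (2 * l - 1) *
      integral {a..b} (\<lambda>y. (poly ((pderiv ^^ l) (pcompose p [:z, h:])) y)\<^sup>2)"
    by (simp add: power_mult_distrib mult_ac)
qed

text \<open>Up to the degree bound the indicator is a finite sum, and every summand is a polynomial expression
in the coefficients and the endpoints.\<close>

lemma jiang_shu_tendsto:
  assumes p: "poly_tendsto N p q F" and X: "(X \<longlongrightarrow> a) F" "(X' \<longlongrightarrow> b) F" and "a < b"
  shows "((\<lambda>h. jiang_shu {X h..X' h} (p h)) \<longlongrightarrow> jiang_shu {a..b} q) F"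
proof -
  define D where "D r l = antideriv (((pderiv ^^ l) r)\<^sup>2)" for r l
  have js: "jiang_shu {s..t} r = (\<Sum>l=1..N. (t - s) ^ (2 * l - 1) * (poly (D r l) t - poly (D r l) s))"
    if "s < t" "degree r \<le> N" for s t r
    using that integral_poly[of s t "((pderiv ^^ _) r)\<^sup>2"]
    by (simp add: jiang_shu_eq_sum D_def poly_fun_simps)
  have D: "((\<lambda>h. poly (D (p h) l) (Z h)) \<longlongrightarrow> poly (D q l) t) F" if "(Z \<longlongrightarrow> t) F" for Z t l
    unfolding D_def
    by (rule poly_tendsto_eval[OF _ that], rule poly_tendsto_antideriv, rule poly_tendsto_square,
        rule poly_tendsto_pderiv_funpow, rule p)
  have "((\<lambda>h. X' h - X h) \<longlongrightarrow> b - a) F" using X by (intro tendsto_diff)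
  then have "\<forall>\<^sub>F h in F. 0 < X' h - X h" using \<open>a < b\<close> by (intro order_tendstoD) auto
  then have "\<forall>\<^sub>F h in F. (\<Sum>l=1..N. (X' h - X h) ^ (2 * l - 1) *
      (poly (D (p h) l) (X' h) - poly (D (p h) l) (X h))) = jiang_shu {X h..X' h} (p h)"
    using p[unfolded poly_tendsto_def, THEN conjunct1] by eventually_elim (simp add: js)
  moreover have "((\<lambda>h. \<Sum>l=1..N. (X' h - X h) ^ (2 * l - 1) *
      (poly (D (p h) l) (X' h) - poly (D (p h) l) (X h))) \<longlongrightarrow> jiang_shu {a..b} q) F"
    using p \<open>a < b\<close> by (subst js) (auto simp: poly_tendsto_def intro!: tendsto_intros X D)
  ultimately show ?thesis by (rule Lim_transform_eventually[rotated])
qed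

text \<open>The term with the first derivative suffices: its integral vanishes only if the derivative is zero
on the whole interval, hence identically.\<close>

lemma jiang_shu_pos:
  assumes "a < b" "1 \<le> degree q"
  shows "0 < jiang_shu {a..b} q"
proof -
  let ?f = "\<lambda>l. integral {a..b} (\<lambda>y. (poly ((pderiv ^^ l) q) y)\<^sup>2)"
  have nonneg: "0 \<le> ?f l" for l
    by (intro integral_nonneg integrable_continuous_interval continuous_intros) auto
  have "?f 1 \<noteq> 0"
  proof
    assume "?f 1 = 0"
    moreover have "continuous_on {a..b} (\<lambda>y. (poly (pderiv q) y)\<^sup>2)"
      by (intro continuous_intros)
    ultimately have "\<forall>y\<in>{a..b}. (poly (pderiv q) y)\<^sup>2 = 0"
      using integral_eq_0_iff[of a b "\<lambda>y. (poly (pderiv q) y)\<^sup>2"] \<open>a < b\<close> by simp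
    then have "{a..b} \<subseteq> {y. poly (pderiv q) y = 0}" by auto
    then have "\<not> finite {y. poly (pderiv q) y = 0}"
      using infinite_Icc[OF \<open>a < b\<close>] finite_subset by blast
    then have "pderiv q = 0" using poly_roots_finite by blast
    then show False using assms by (simp add: pderiv_eq_0_iff)
  qed
  then have "0 < (b - a) ^ (2 * 1 - 1) * ?f 1"
    using nonneg[of 1] \<open>a < b\<close> by simp
  also have "\<dots> \<le> (\<Sum>l=1..degree q. (b - a) ^ (2 * l - 1) * ?f l)"
    using assms nonneg
    by (intro member_le_sum[where f = "\<lambda>l. (b - a) ^ (2 * l - 1) * ?f l"]) auto
  also have "\<dots> = jiang_shu {a..b} q" by (rule jiang_shu_eq_sum[OF \<open>a < b\<close> order_refl, symmetric])
  finally show ?thesis .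
qed

section \<open>Cell integrals near the jump\<close>

lemma has_integral_step:
  assumes "a \<le> b"
  shows "((\<lambda>t. if t < z then ul else ur) has_integral hinge ul ur (b - z) - hinge ul ur (a - z)) {a..b}"
proof (rule fundamental_theorem_of_calculus_strong[of "{z}"])
  show "continuous_on {a..b} (\<lambda>t. hinge ul ur (t - z))"
    unfolding hinge_def by (intro continuous_intros)
next
  fix t assume "t \<in> {a..b} - {z}"
  then consider "t < z" | "z < t" by fastforce
  then show "((\<lambda>t. hinge ul ur (t - z)) has_vector_derivative (if t < z then ul else ur)) (at t)"
  proof cases
    case 1
    have "((\<lambda>t. ul * (t - z)) has_vector_derivative ul) (at t)"
      unfolding has_real_derivative_iff_has_vector_derivative[symmetric]
      by (auto intro!: derivative_eq_intros)
    then show ?thesis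
      using 1 by (auto simp: hinge_def
          intro: has_vector_derivative_transform_within_open[where S = "{..<z}"])
  next
    case 2
    have "((\<lambda>t. ur * (t - z)) has_vector_derivative ur) (at t)"
      unfolding has_real_derivative_iff_has_vector_derivative[symmetric]
      by (auto intro!: derivative_eq_intros)
    then show ?thesis
      using 2 by (auto simp: hinge_def
          intro: has_vector_derivative_transform_within_open[where S = "{z<..}"])
  qed
qed (use assms in auto)

text \<open>Turns one-sided limits at the jump into continuity up to the jump, whatever the value of
the function there.\<close>

lemma continuous_on_fill_point:
  fixes u :: "'a::t1_space \<Rightarrow> 'b::topological_space"
  assumes u: "continuous_on (A - {z}) u" and l: "(u \<longlongrightarrow> l) (at z within A)"
  shows "continuous_on A (u(z := l))"
  unfolding continuous_on_def
proof
  fix t assume "t \<in> A"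
  show "(u(z := l) \<longlongrightarrow> (u(z := l)) t) (at t within A)"
  proof (cases "t = z")
    case True
    have "\<forall>\<^sub>F s in at z within A. u s = (u(z := l)) s"
      by (simp add: eventually_at_filter)
    then show ?thesis using Lim_transform_eventually[OF l] True by auto
  next
    case False
    have "at t within A = at t within (A - {z})"
      using False by (intro at_within_nhd[of t "- {z}"]) auto
    then have "(u \<longlongrightarrow> u t) (at t within A)"
      using u False \<open>t \<in> A\<close> by (simp add: continuous_on_def)
    moreover have "\<forall>\<^sub>F s in at t within A. s \<in> - {z}"
      using False by (intro eventually_at_in_open' topological_tendstoD[OF tendsto_ident_at]) auto
    then have "\<forall>\<^sub>F s in at t within A. u s = (u(z := l)) s"
      by (rule eventually_mono) auto
    ultimately show ?thesis using Lim_transform_eventually False by fastforce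
  qed
qed

lemma integrable_across_jump:
  fixes u :: "real \<Rightarrow> real"
  assumes u: "continuous_on ({a..b} - {z}) u" and z: "a < z" "z < b"
    and l: "(u \<longlongrightarrow> ul) (at_left z)" "(u \<longlongrightarrow> ur) (at_right z)"
  shows "u integrable_on {a..b}"
proof (rule Henstock_Kurzweil_Integration.integrable_combine)
  have "continuous_on {a..z} (u(z := ul))"
    by (rule continuous_on_fill_point)
      (use u z l in \<open>auto simp: at_within_Icc_at_left intro: continuous_on_subset\<close>)
  then have "u(z := ul) integrable_on {a..z}" by (rule integrable_continuous_interval)
  then show "u integrable_on {a..z}"
    by (rule integrable_spike_finite[of "{z}", rotated 2]) auto
  have "continuous_on {z..b} (u(z := ur))"
    by (rule continuous_on_fill_point)
      (use u z l in \<open>auto simp: at_within_Icc_at_right intro: continuous_on_subset\<close>)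
  then have "u(z := ur) integrable_on {z..b}" by (rule integrable_continuous_interval)
  then show "u integrable_on {z..b}"
    by (rule integrable_spike_finite[of "{z}", rotated 2]) auto
qed (use z in auto)

lemma hinge_scale: "0 < h \<Longrightarrow> hinge ul ur (h * t) = h * hinge ul ur t"
  by (cases "0 \<le> t") (auto simp: hinge_def algebra_simps mult_le_0_iff zero_le_mult_iff min_def max_def)

lemma tendsto_hinge: "(f \<longlongrightarrow> t) F \<Longrightarrow> ((\<lambda>h. hinge ul ur (f h)) \<longlongrightarrow> hinge ul ur t) F"
  unfolding hinge_def by (intro tendsto_intros)

text \<open>Seen at scale \<open>h\<close> around the jump, \<open>u\<close> looks like a step function: the
cells shrink to \<open>z\<close>, where \<open>u\<close> differs from its one-sided limits by at most
\<open>\<epsilon>\<close>, and the error in the integral is at most \<open>\<epsilon>\<close> times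
the length of the cell, which is of order \<open>h\<close>.\<close>

lemma scaled_cell_integral_tendsto:
  fixes u :: "real \<Rightarrow> real"
  assumes l: "(u \<longlongrightarrow> ul) (at_left z)" "(u \<longlongrightarrow> ur) (at_right z)"
    and a: "(a \<longlongrightarrow> \<alpha>) (at_right 0)" and b: "(b \<longlongrightarrow> \<beta>) (at_right 0)"
    and ab: "\<forall>\<^sub>F h in at_right 0. a h \<le> b h"
    and int: "\<forall>\<^sub>F h in at_right 0. u integrable_on {z + h * a h..z + h * b h}"
  shows "((\<lambda>h. integral {z + h * a h..z + h * b h} u / h) \<longlongrightarrow> hinge ul ur \<beta> - hinge ul ur \<alpha>) (at_right 0)"
proof -
  define E where "E h = integral {z + h * a h..z + h * b h} u / h - (hinge ul ur (b h) - hinge ul ur (a h))" for h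
  have bound: "\<forall>\<^sub>F h in at_right 0. \<bar>E h\<bar> \<le> \<epsilon> * (b h - a h)" if "0 < \<epsilon>" for \<epsilon>
  proof -
    have "\<forall>\<^sub>F t in at_left z. dist (u t) ul < \<epsilon>" using l(1) that by (rule tendstoD)
    then obtain lo where lo: "lo < z" "\<And>t. lo < t \<Longrightarrow> t < z \<Longrightarrow> dist (u t) ul < \<epsilon>"
      by (auto simp: eventually_at_left[of "z - 1"])
    have "\<forall>\<^sub>F t in at_right z. dist (u t) ur < \<epsilon>" using l(2) that by (rule tendstoD)
    then obtain hi where hi: "z < hi" "\<And>t. z < t \<Longrightarrow> t < hi \<Longrightarrow> dist (u t) ur < \<epsilon>"
      by (auto simp: eventually_at_right[of _ "z + 1"])
    have "((\<lambda>h. z + h * a h) \<longlongrightarrow> z + 0 * \<alpha>) (at_right 0)"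
      by (intro tendsto_intros a)
    then have "\<forall>\<^sub>F h in at_right 0. lo < z + h * a h" using lo by (intro order_tendstoD) auto
    moreover have "((\<lambda>h. z + h * b h) \<longlongrightarrow> z + 0 * \<beta>) (at_right 0)"
      by (intro tendsto_intros b)
    then have "\<forall>\<^sub>F h in at_right 0. z + h * b h < hi" using hi by (intro order_tendstoD) auto
    moreover have "\<forall>\<^sub>F h in at_right 0. 0 < (h::real)" by (simp add: eventually_at_filter)
    ultimately show ?thesis using ab int
    proof eventually_elim
      case (elim h)
      let ?a = "z + h * a h" and ?b = "z + h * b h"
      let ?s = "\<lambda>t. if t < z then ul else ur"
      have le: "?a \<le> ?b" using elim by simp
      have "((\<lambda>t. u t - ?s t) has_integral
          integral {?a..?b} u - (hinge ul ur (?b - z) - hinge ul ur (?a - z))) (cbox ?a ?b)"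
        unfolding interval_cbox[symmetric]
        by (intro has_integral_diff integrable_integral has_integral_step le elim)
      then have "norm (integral {?a..?b} u - (hinge ul ur (?b - z) - hinge ul ur (?a - z)))
          \<le> \<epsilon> * measure lborel (cbox ?a ?b)"
      proof (rule has_integral_bound_spike_finite[rotated 2])
        fix t assume "t \<in> cbox ?a ?b - {z}"
        then consider "lo < t" "t < z" | "z < t" "t < hi" using elim by fastforce
        then show "norm (u t - ?s t) \<le> \<epsilon>"
          by cases (use lo(2)[of t] hi(2)[of t] in \<open>auto simp: dist_norm\<close>)
      qed (use \<open>0 < \<epsilon>\<close> in auto)
      moreover have "integral {?a..?b} u - (hinge ul ur (?b - z) - hinge ul ur (?a - z)) = h * E h"
        using elim by (simp add: E_def hinge_scale field_simps)
      moreover have "measure lborel (cbox ?a ?b) = h * (b h - a h)"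
        using le by (simp add: algebra_simps)
      ultimately have "h * \<bar>E h\<bar> \<le> h * (\<epsilon> * (b h - a h))"
        using elim by (simp add: abs_mult mult_ac)
      then show ?case using elim by (simp add: mult_le_cancel_left)
    qed
  qed
  have "(E \<longlongrightarrow> 0) (at_right 0)"
  proof (rule tendstoI)
    fix e :: real assume "0 < e"
    \<comment> \<open>Eventually an upper bound for the cell length; the summand 1 makes it exceed the limit and be positive.\<close>
    define K where "K = \<bar>\<beta> - \<alpha>\<bar> + 1"
    have "((\<lambda>h. b h - a h) \<longlongrightarrow> \<beta> - \<alpha>) (at_right 0)" by (intro tendsto_diff a b)
    then have "\<forall>\<^sub>F h in at_right 0. b h - a h < K"
      by (rule order_tendstoD) (simp add: K_def)
    moreover have "\<forall>\<^sub>F h in at_right 0. \<bar>E h\<bar> \<le> e / K * (b h - a h)"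
      using \<open>0 < e\<close> by (intro bound) (simp add: K_def)
    ultimately show "\<forall>\<^sub>F h in at_right 0. dist (E h) 0 < e"
    proof eventually_elim
      case (elim h)
      have "e / K * (b h - a h) < e / K * K"
        using elim \<open>0 < e\<close> by (intro mult_strict_left_mono) (auto simp: K_def)
      also have "\<dots> = e" by (simp add: K_def)
      finally show ?case using elim by simp
    qed
  qed
  then have "((\<lambda>h. E h + (hinge ul ur (b h) - hinge ul ur (a h))) \<longlongrightarrow>
      0 + (hinge ul ur \<beta> - hinge ul ur \<alpha>)) (at_right 0)"
    by (intro tendsto_add tendsto_diff tendsto_hinge a b)
  then show ?thesis by (simp add: E_def)
qed

section \<open>The polynomial P0\<close>

lemma coeff_cweno_P0:
  "coeff (cweno_P0 m d Q R) n = (coeff Q n - (\<Sum>k = 1..m. d k * coeff (R k) n)) / d 0"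
  by (simp add: cweno_P0_def coeff_sum)

lemma pcompose_cweno_P0:
  "pcompose (cweno_P0 m d Q R) s = cweno_P0 m d (pcompose Q s) (\<lambda>k. pcompose (R k) s)"
  by (simp add: cweno_P0_def pcompose_smult pcompose_diff pcompose_sum)

lemma poly_tendsto_cweno_P0:
  assumes Q: "poly_tendsto N p q F"
    and R: "\<And>k. k \<in> {1..m} \<Longrightarrow> poly_tendsto N (\<lambda>h. r h k) (R k) F"
  shows "poly_tendsto N (\<lambda>h. cweno_P0 m d (p h) (r h)) (cweno_P0 m d q R) F"
proof -
  have deg: "degree (cweno_P0 m d q' R') \<le> N"
    if "degree q' \<le> N" "\<forall>k\<in>{1..m}. degree (R' k) \<le> N" for q' R'
    using that by (intro degree_le) (auto simp: coeff_cweno_P0 coeff_eq_0 intro!: sum.neutral)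
  have "\<forall>\<^sub>F h in F. \<forall>k\<in>{1..m}. degree (r h k) \<le> N"
    using R by (intro eventually_ball_finite) (auto simp: poly_tendsto_def)
  moreover have "\<forall>\<^sub>F h in F. degree (p h) \<le> N" using Q by (simp add: poly_tendsto_def)
  ultimately have "\<forall>\<^sub>F h in F. degree (cweno_P0 m d (p h) (r h)) \<le> N"
    by eventually_elim (rule deg)
  moreover have "degree (cweno_P0 m d q R) \<le> N"
    using Q R by (intro deg) (auto simp: poly_tendsto_def)
  moreover have "((\<lambda>h. coeff (cweno_P0 m d (p h) (r h)) i) \<longlongrightarrow> coeff (cweno_P0 m d q R) i) F" for i
    unfolding coeff_cweno_P0 divide_inverse
    using Q R by (intro tendsto_mult tendsto_diff tendsto_sum tendsto_const) (auto simp: poly_tendsto_def)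
  ultimately show ?thesis by (simp add: poly_tendsto_def)
qed

text \<open>The coefficients that the polynomials \<open>R k\<close> contribute at degree \<open>degree Q\<close> can only
cancel a fraction of the leading coefficient of \<open>Q\<close>, because the weights
\<open>d 1, ..., d m\<close> sum to \<open>1 - d 0 < 1\<close>. The dichotomy in the hypothesis is what
interpolation on a substencil gives.\<close>

lemma degree_cweno_P0:
  assumes d: "\<And>k. k \<le> m \<Longrightarrow> 0 < d k" "(\<Sum>k\<le>m. d k) = 1"
    and Q: "1 \<le> degree Q"
    and R: "\<And>k. k \<in> {1..m} \<Longrightarrow> coeff (R k) (degree Q) \<in> {0, lead_coeff Q}"
  shows "1 \<le> degree (cweno_P0 m d Q R)"
proof -
  define e where "e k = (if coeff (R k) (degree Q) = 0 then 0 else 1 :: real)" for k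
  have R: "coeff (R k) (degree Q) = e k * lead_coeff Q" if "k \<in> {1..m}" for k
    using R[OF that] by (auto simp: e_def)
  have "{..m} = insert 0 {1..m}" by auto
  then have "d 0 + (\<Sum>k = 1..m. d k) = 1" using d(2) by simp
  moreover have "(\<Sum>k = 1..m. d k * e k) \<le> (\<Sum>k = 1..m. d k)"
    using d(1) by (intro sum_mono) (auto simp: e_def less_imp_le)
  ultimately have less: "(\<Sum>k = 1..m. d k * e k) < 1" using d(1)[of 0] by simp
  have "(\<Sum>k = 1..m. d k * coeff (R k) (degree Q)) = (\<Sum>k = 1..m. d k * e k) * lead_coeff Q"
    by (simp add: R sum_distrib_right mult.assoc)
  then have "coeff (cweno_P0 m d Q R) (degree Q) = (1 - (\<Sum>k = 1..m. d k * e k)) * lead_coeff Q / d 0"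
    by (simp add: coeff_cweno_P0 left_diff_distrib)
  also have "\<dots> \<noteq> 0" using less Q d(1)[of 0] by auto
  finally show ?thesis using Q le_degree order_trans by blast
qed

section \<open>The indicator of P0 at a jump\<close>

text \<open>The limit in \<^const>\<open>same_order\<close> is only known to be nonzero; for a length it must be
positive.\<close>

lemma same_order_id_pos:
  assumes "same_order f (\<lambda>h. h)" and "\<forall>\<^sub>F h in at_right 0. 0 \<le> f h"
  obtains l where "0 < l" "((\<lambda>h. f h / h) \<longlongrightarrow> l) (at_right 0)"
proof -
  obtain l where l: "l \<noteq> 0" "((\<lambda>h. f h / h) \<longlongrightarrow> l) (at_right 0)"
    using assms(1) by (auto simp: same_order_def)
  have "\<forall>\<^sub>F h in at_right 0. 0 < (h :: real)" by (simp add: eventually_at_filter)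
  with assms(2) have "\<forall>\<^sub>F h in at_right 0. 0 \<le> f h / h"
    by eventually_elim simp
  then have "0 \<le> l" using tendsto_lowerbound[OF l(2)] by simp
  then have "0 < l" using l(1) by simp
  then show thesis using l(2) by (rule that)
qed

lemma cell_integral_eq:
  assumes "cell_average x f j = cell_average x u j" "x j < x (Suc j)"
  shows "integral {x j..x (Suc j)} f = integral {x j..x (Suc j)} u"
  using assms by (simp add: cell_average_def cell_def)

theorem theorem2:
  fixes u :: "real \<Rightarrow> real" and z :: real
    and G g m c :: nat
    and d :: "nat \<Rightarrow> real" and \<delta> h0 :: real
    and x :: "real \<Rightarrow> nat \<Rightarrow> real"
    and S :: "nat \<Rightarrow> nat set"
    and Popt :: "real \<Rightarrow> real poly" and P :: "real \<Rightarrow> nat \<Rightarrow> real poly"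
  assumes "g < G" and "1 \<le> m" and "c \<le> G"
    and coeffs: "\<And>k. k \<le> m \<Longrightarrow> 0 < d k \<and> d k \<le> 1" "(\<Sum>k\<le>m. d k) = 1"
    and "0 < \<delta>" and "\<delta> \<le> d 0"
    and "0 < h0"
    and grid: "\<And>h j. h \<in> {0<..<h0} \<Longrightarrow> j \<le> G \<Longrightarrow> x h j < x h (Suc j)"
    and mesh_size: "\<And>j. j \<le> G \<Longrightarrow> same_order (\<lambda>h. diameter (cell (x h) j)) (\<lambda>h. h)"
    and jump: "jump_discontinuity_at u z"
    and jump_in_stencil: "\<And>h. h \<in> {0<..<h0} \<Longrightarrow> z \<in> {x h 0<..<x h (Suc G)}"
    and jump_position: "same_order (\<lambda>h. z - x h 0) (\<lambda>h. h)"
      "same_order (\<lambda>h. x h (Suc G) - z) (\<lambda>h. h)"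
    and single_discontinuity:
      "\<And>h. h \<in> {0<..<h0} \<Longrightarrow> continuous_on ({x h 0..x h (Suc G)} - {z}) u"
    and Popt: "\<And>h. h \<in> {0<..<h0} \<Longrightarrow> average_interpolant (x h) u {..G} (Popt h)"
    and substencil: "\<And>k. k \<in> {1..m} \<Longrightarrow> S k \<subseteq> {..G}"
    and P: "\<And>h k. h \<in> {0<..<h0} \<Longrightarrow> k \<in> {1..m} \<Longrightarrow>
      average_interpolant (x h) u (S k) (P h k) \<and> degree (P h k) \<le> g"
  shows "same_order
    (\<lambda>h. jiang_shu (cell (x h) c) (cweno_P0 m d (Popt h) (P h))) (\<lambda>h. 1)"
proof -
  let ?F = "at_right (0 :: real)"
  \<comment> \<open>Interfaces and interpolants in the variable \<open>y = (t - z) / h\<close>, which puts the jump at 0.\<close>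
  define X where "X h j = (x h j - z) / h" for h j
  define q where "q h = pcompose (Popt h) [:z, h:]" for h
  define r where "r h k = pcompose (P h k) [:z, h:]" for h k
  have small: "\<forall>\<^sub>F h in ?F. h \<in> {0<..<h0}"
    using \<open>0 < h0\<close> by (rule eventually_at_right_real)
  have x: "x h j = z + h * X h j" if "h \<in> {0<..<h0}" for h j
    using that by (simp add: X_def)
  have X_less: "X h j < X h (Suc j)" if "h \<in> {0<..<h0}" "j \<le> G" for h j
    using grid[OF that] that by (simp add: X_def divide_strict_right_mono)
  obtain ul ur where lim_u: "(u \<longlongrightarrow> ul) (at_left z)" "(u \<longlongrightarrow> ur) (at_right z)" "ul \<noteq> ur"
    using jump by (auto simp: jump_discontinuity_at_def)

  have "\<forall>j\<in>{..G}. \<exists>l. 0 < l \<and> ((\<lambda>h. X h (Suc j) - X h j) \<longlongrightarrow> l) ?F"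
  proof
    fix j assume "j \<in> {..G}"
    then have j: "j \<le> G" by simp
    have diam: "diameter (cell (x h) j) = x h (Suc j) - x h j" if "h \<in> {0<..<h0}" for h
      using grid[OF that j] by (simp add: cell_def)
    have "\<forall>\<^sub>F h in ?F. 0 \<le> diameter (cell (x h) j)"
      using small by eventually_elim (use diam grid[OF _ j] in \<open>simp add: less_imp_le\<close>)
    then obtain l where l: "0 < l" "((\<lambda>h. diameter (cell (x h) j) / h) \<longlongrightarrow> l) ?F"
      using same_order_id_pos[OF mesh_size[OF j]] by blast
    have "\<forall>\<^sub>F h in ?F. diameter (cell (x h) j) / h = X h (Suc j) - X h j"
      using small by eventually_elim (simp add: diam X_def diff_divide_distrib)
    then have "((\<lambda>h. X h (Suc j) - X h j) \<longlongrightarrow> l) ?F"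
      by (rule Lim_transform_eventually[OF l(2)])
    then show "\<exists>l. 0 < l \<and> ((\<lambda>h. X h (Suc j) - X h j) \<longlongrightarrow> l) ?F" using l(1) by blast
  qed
  from bchoice[OF this] obtain len where len: "\<And>j. j \<le> G \<Longrightarrow> 0 < len j"
      "\<And>j. j \<le> G \<Longrightarrow> ((\<lambda>h. X h (Suc j) - X h j) \<longlongrightarrow> len j) ?F"
    by auto
  have "\<forall>\<^sub>F h in ?F. 0 \<le> z - x h 0"
    using small by eventually_elim (use jump_in_stencil in force)
  then obtain a where a: "0 < a" "((\<lambda>h. (z - x h 0) / h) \<longlongrightarrow> a) ?F"
    using same_order_id_pos[OF jump_position(1)] by blast
  have "\<forall>\<^sub>F h in ?F. 0 \<le> x h (Suc G) - z"
    using small by eventually_elim (use jump_in_stencil in force)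
  then obtain b where b: "0 < b" "((\<lambda>h. (x h (Suc G) - z) / h) \<longlongrightarrow> b) ?F"
    using same_order_id_pos[OF jump_position(2)] by blast
  \<comment> \<open>The limit interfaces: \<open>- a\<close> is the left end of the limit stencil and \<open>len i\<close> its cell lengths.\<close>
  define Y where "Y j = (\<Sum>i<j. len i) - a" for j
  have Y_less: "Y j < Y (Suc j)" if "j \<le> G" for j
    using len(1)[OF that] by (simp add: Y_def)
  have X_lim: "((\<lambda>h. X h j) \<longlongrightarrow> Y j) ?F" if "j \<le> Suc G" for j
  proof -
    have "((\<lambda>h. (\<Sum>i<j. X h (Suc i) - X h i) - (z - x h 0) / h) \<longlongrightarrow> Y j) ?F"
      unfolding Y_def using that by (intro tendsto_diff tendsto_sum len a) auto
    moreover have "(\<Sum>i<j. X h (Suc i) - X h i) - (z - x h 0) / h = X h j" for h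
      unfolding sum_lessThan_telescope by (simp add: X_def diff_divide_distrib)
    ultimately show ?thesis by simp
  qed
  have Y0: "Y 0 < 0" using a by (simp add: Y_def)
  have "Y (Suc G) = b"
    using tendsto_unique[OF _ X_lim[of "Suc G"]] b(2) by (simp add: X_def)
  with b have YG: "0 < Y (Suc G)" by simp

  define T where "T j = hinge ul ur (Y (Suc j)) - hinge ul ur (Y j)" for j
  have data: "((\<lambda>h. integral {x h j..x h (Suc j)} u / h) \<longlongrightarrow> T j) ?F" if j: "j \<le> G" for j
  proof -
    have int: "u integrable_on {x h j..x h (Suc j)}" if h: "h \<in> {0<..<h0}" for h
    proof -
      have mono: "x h i \<le> x h k" if "i \<le> k" "k \<le> Suc G" for i k
        using that
      proof (induction rule: dec_induct)
        case (step n)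
        then show ?case using grid[OF h, of n] by simp
      qed simp
      have "u integrable_on {x h 0..x h (Suc G)}"
        using single_discontinuity[OF h] jump_in_stencil[OF h] lim_u
        by (intro integrable_across_jump) auto
      then show ?thesis
        by (rule integrable_on_subinterval) (use mono[of 0 j] mono[of "Suc j" "Suc G"] j in auto)
    qed
    have "((\<lambda>h. integral {z + h * X h j..z + h * X h (Suc j)} u / h) \<longlongrightarrow> T j) ?F"
      unfolding T_def
    proof (rule scaled_cell_integral_tendsto[OF lim_u(1,2)])
      show "((\<lambda>h. X h j) \<longlongrightarrow> Y j) ?F" "((\<lambda>h. X h (Suc j)) \<longlongrightarrow> Y (Suc j)) ?F"
        using j by (auto intro: X_lim)
      show "\<forall>\<^sub>F h in ?F. X h j \<le> X h (Suc j)"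
        using small by eventually_elim (use X_less j in \<open>auto intro: less_imp_le\<close>)
      show "\<forall>\<^sub>F h in ?F. u integrable_on {z + h * X h j..z + h * X h (Suc j)}"
        using small by eventually_elim (use int in \<open>simp add: x\<close>)
    qed
    then show ?thesis
      by (rule Lim_transform_eventually) (use small in eventually_elim, simp add: x)
  qed
  have interpolant_limit: "\<exists>Q. degree Q < card A \<and> poly_tendsto G (\<lambda>h. pcompose (p h) [:z, h:]) Q ?F \<and>
      (\<forall>j\<in>A. poly (antideriv Q) (Y (Suc j)) - poly (antideriv Q) (Y j) = T j)"
    if p: "\<And>h. h \<in> {0<..<h0} \<Longrightarrow> average_interpolant (x h) u A (p h)" and A: "A \<subseteq> {..G}" for p A
  proof -
    let ?p = "\<lambda>h. pcompose (p h) [:z, h:]"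
    have "\<forall>\<^sub>F h in ?F. degree (?p h) < card A"
      using small by eventually_elim (use p in \<open>auto simp: degree_pcompose average_interpolant_def\<close>)
    moreover have "((\<lambda>h. poly (antideriv (?p h)) (X h (Suc j)) - poly (antideriv (?p h)) (X h j)) \<longlongrightarrow> T j) ?F"
      if j: "j \<in> A" for j
    proof -
      have jG: "j \<le> G" using j A by auto
      have "\<forall>\<^sub>F h in ?F. integral {x h j..x h (Suc j)} u / h =
          poly (antideriv (?p h)) (X h (Suc j)) - poly (antideriv (?p h)) (X h j)"
        using small
      proof eventually_elim
        case (elim h)
        have "integral {x h j..x h (Suc j)} u = integral {x h j..x h (Suc j)} (poly (p h))"
          using p[OF elim] j grid[OF elim jG]
          by (intro cell_integral_eq[symmetric]) (auto simp: average_interpolant_def)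
        also have "\<dots> = h * integral {X h j..X h (Suc j)} (poly (?p h))"
          using elim X_less[OF elim jG] by (simp add: x integral_poly_affine)
        finally show ?case
          using elim X_less[OF elim jG] by (simp add: integral_poly)
      qed
      with data[OF jG] show ?thesis by (rule Lim_transform_eventually)
    qed
    ultimately obtain Q where "degree Q < card A"
        "\<And>N. card A \<le> Suc N \<Longrightarrow> poly_tendsto N ?p Q ?F"
        "\<And>j. j \<in> A \<Longrightarrow> poly (antideriv Q) (Y (Suc j)) - poly (antideriv Q) (Y j) = T j"
      using interpolants_tendsto[where X = X and Y = Y and p = ?p and T = T and F = ?F,
          OF trivial_limit_at_right_real Y_less A X_lim] by blast
    moreover have "card A \<le> Suc G" using card_mono[OF _ A] by simp
    ultimately show ?thesis by blast
  qed
  obtain Q where Q: "degree Q < card {..G}" "poly_tendsto G q Q ?F"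
      "\<And>j. j \<le> G \<Longrightarrow> poly (antideriv Q) (Y (Suc j)) - poly (antideriv Q) (Y j) = T j"
    using interpolant_limit[OF Popt] unfolding q_def by auto
  have "\<forall>k\<in>{1..m}. \<exists>R. degree R < card (S k) \<and> poly_tendsto G (\<lambda>h. r h k) R ?F \<and>
      (\<forall>j\<in>S k. poly (antideriv R) (Y (Suc j)) - poly (antideriv R) (Y j) = T j)"
    unfolding r_def using P substencil by (intro ballI interpolant_limit) auto
  from bchoice[OF this] obtain R where R: "\<And>k. k \<in> {1..m} \<Longrightarrow> degree (R k) < card (S k)"
      "\<And>k. k \<in> {1..m} \<Longrightarrow> poly_tendsto G (\<lambda>h. r h k) (R k) ?F"
      "\<And>k j. k \<in> {1..m} \<Longrightarrow> j \<in> S k \<Longrightarrow>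
        poly (antideriv (R k)) (Y (Suc j)) - poly (antideriv (R k)) (Y j) = T j"
    by blast
  have deg_Q: "1 \<le> degree Q"
    using step_interpolant_nonconstant[OF _ Y_less Y0 YG lim_u(3), of Q] Q(3) \<open>g < G\<close>
    by (auto simp: T_def)
  have "coeff (R k) (degree Q) \<in> {0, lead_coeff Q}" if k: "k \<in> {1..m}" for k
  proof (cases "degree (R k) < degree Q")
    case False
    \<comment> \<open>The substencil then has more cells than the degree of \<open>Q\<close>, so \<open>Q\<close> itself is the interpolant on it.\<close>
    then have deg: "degree (Q - R k) < card (S k)"
      using R(1)[OF k] degree_diff_le_max[of Q "R k"] by simp
    have "poly (antideriv (Q - R k)) (Y (Suc j)) = poly (antideriv (Q - R k)) (Y j)" if "j \<in> S k" for j
    proof -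
      have "j \<le> G" using that substencil[OF k] by auto
      then show ?thesis using Q(3) R(3)[OF k that] by (simp add: antideriv_diff algebra_simps)
    qed
    with Y_less substencil[OF k] deg have "Q - R k = 0"
      by (rule poly_eq_0_if_cell_integrals_vanish)
    then show ?thesis by simp
  qed (simp add: coeff_eq_0)
  then have deg_P0: "1 \<le> degree (cweno_P0 m d Q R)"
    using coeffs deg_Q by (intro degree_cweno_P0) auto

  have "((\<lambda>h. jiang_shu {X h c..X h (Suc c)} (cweno_P0 m d (q h) (r h))) \<longlongrightarrow>
      jiang_shu {Y c..Y (Suc c)} (cweno_P0 m d Q R)) ?F"
    using \<open>c \<le> G\<close>
    by (intro jiang_shu_tendsto[where N = G] poly_tendsto_cweno_P0 Q(2) R(2) X_lim Y_less) auto
  moreover have "\<forall>\<^sub>F h in ?F. jiang_shu {X h c..X h (Suc c)} (cweno_P0 m d (q h) (r h)) =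
      jiang_shu (cell (x h) c) (cweno_P0 m d (Popt h) (P h))"
    using small
  proof eventually_elim
    case (elim h)
    have "jiang_shu (cell (x h) c) (cweno_P0 m d (Popt h) (P h)) =
        jiang_shu {z + h * X h c..z + h * X h (Suc c)} (cweno_P0 m d (Popt h) (P h))"
      using elim by (simp add: cell_def x)
    then show ?case
      using elim X_less[OF elim \<open>c \<le> G\<close>]
      by (simp add: jiang_shu_affine pcompose_cweno_P0 q_def r_def[abs_def])
  qed
  ultimately have "((\<lambda>h. jiang_shu (cell (x h) c) (cweno_P0 m d (Popt h) (P h)) / 1) \<longlongrightarrow>
      jiang_shu {Y c..Y (Suc c)} (cweno_P0 m d Q R)) ?F"
    unfolding div_by_1 by (rule Lim_transform_eventually)
  moreover have "jiang_shu {Y c..Y (Suc c)} (cweno_P0 m d Q R) \<noteq> 0"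
    using jiang_shu_pos[OF Y_less[OF \<open>c \<le> G\<close>] deg_P0] by simp
  ultimately show ?thesis unfolding same_order_def by blast
qed

end
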